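(* Let $D$ be a reduced diagram of a knot, let $f$ be a bounded face of $D$ adjacent to the unbounded face, and let $\widetilde{M}(D)$ be the presentation matrix for the torsion subgroup of the Dehn coloring module of $D$ obtained from the Dehn relations matrix $\widetilde{M}'(D)$ by removing the column corresponding to $f$. Then the weighted bipartite graph $\Gamma_{\widetilde{M}(D)}$ (with edges of weight $0$ omitted) is the weighted balanced overlaid Tait graph of $D$ obtained by omitting the face $f$; that is, its vertices correspond to the crossings and to the bounded faces of $D$ other than $f$, a crossing and a face are joined by an edge exactly when the crossing is incident to the face, and each edge is weighted by the coefficient of the face in the Dehn coloring relation of the crossing.
   Context: A knot diagram $D$ is a planar diagram; its faces are the connected components of the complement in the plane of the underlying $4$-valent planar curve. $D$ is reduced if at each crossing the four surrounding corners belong to four distinct faces. Two faces are adjacent if they are separated by (a portion of) an arc of $D$. Dehn relation: at a crossing, let $f_1,f_2$ be the two faces lying on either side of the over strand just before the crossing (in some direction of travel along the over strand) and $f_3,f_4$ the two faces lying on either side of the over strand just after the crossing. The Dehn coloring relation is $f_1+f_2=f_3+f_4$, i.e. $-f_1-f_2+f_3+f_4=0$; which side gets the minus sign is an arbitrary choice at each crossing. The unbounded face is set equal to $0$. The Dehn coloring module of $D$ is the abelian group generated by the faces of $D$ subject to all Dehn relations over $\mathbb{Z}$, with the unbounded face set to $0$. Its relations matrix $\widetilde{M}'(D)$ has one row for each crossing and one column for each bounded face, the entries being the coefficients in the Dehn relations. $\widetilde{M}(D)$ is obtained by deleting the column of a bounded face $f$ adjacent to the unbounded face. For a $p\times q$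 matrix $X=(x_{ij})$, $\Gamma_X$ is the weighted bipartite graph with vertex sets $\{v_1,\dots,v_p\}$ and $\{w_1,\dots,w_q\}$ and weight $x_{ij}$ on the edge $v_iw_j$; edges of weight $0$ are omitted. The balanced overlaid Tait (BOT) graph of $D$ (omitting the face $f$) is the bipartite graph $\Gamma_D=(V,W,E)$ where $V$ is the set of crossings of $D$, $W$ is the set of all bounded faces of $D$ except $f$, and $xy\in E$ if and only if the crossing $x$ is incident to the face $y$. It is regarded as a plane graph with the embedding coming from the diagram. *)

theory Defs
  imports "HOL-Analysis.Smooth_Paths" "Jordan_Normal_Form.Matrix"
begin

section \<open>Knot diagrams\<close>

text \<open>
  A diagram is a closed curve in the plane, parametrised by \<open>{0..1}\<close>, together with a choice,
  for every crossing, of the parameter at which the curve runs along the over strand.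
\<close>

record diagram =
  curve :: "real \<Rightarrow> complex"
  over :: "complex \<Rightarrow> real"

definition params :: "diagram \<Rightarrow> complex \<Rightarrow> real set" where
  "params D c = {t \<in> {0..<1}. curve D t = c}"

definition crossings :: "diagram \<Rightarrow> complex set" where
  "crossings D = {c. \<exists>s \<in> params D c. \<exists>t \<in> params D c. s \<noteq> t}"

text \<open>
  Regularity is required only near the crossings, where the two strands must be \<open>C\<^sup>1\<close> and meet
  transversally (linearly independent velocities). Elsewhere the curve is merely continuous and
  injective, so that smooth as well as polygonal diagrams are covered. The base point of the
  parametrisation is chosen away from the crossings.
\<close>

definition knot_diagram :: "diagram \<Rightarrow> bool" where
  "knot_diagram D \<longleftrightarrow>
     path (curve D) \<and> pathfinish (curve D) = pathstart (curve D) \<and>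
     finite (crossings D) \<and> pathstart (curve D) \<notin> crossings D \<and>
     (\<forall>c \<in> crossings D.
        card (params D c) = 2 \<and> over D c \<in> params D c \<and>
        (\<forall>t \<in> params D c. \<exists>\<delta>>0. curve D C1_differentiable_on {t - \<delta><..<t + \<delta>}) \<and>
        (\<forall>s \<in> params D c. \<forall>t \<in> params D c. s \<noteq> t \<longrightarrow>
           \<not> collinear {0, vector_derivative (curve D) (at s), vector_derivative (curve D) (at t)}))"

section \<open>Faces\<close>

definition faces :: "diagram \<Rightarrow> complex set set" where
  "faces D = components (- path_image (curve D))"

definition bounded_faces :: "diagram \<Rightarrow> complex set set" where
  "bounded_faces D = {F \<in> faces D. bounded F}"

text \<open>The curve is compact, so its outside is the unique unbounded component of the complement.\<close>

definition unbounded_face :: "diagram \<Rightarrow> complex set" where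
  "unbounded_face D = outside (path_image (curve D))"

definition adjacent_faces :: "diagram \<Rightarrow> complex set \<Rightarrow> complex set \<Rightarrow> bool" where
  "adjacent_faces D F G \<longleftrightarrow> F \<noteq> G \<and>
     (\<exists>a b. 0 \<le> a \<and> a < b \<and> b \<le> 1 \<and> curve D ` {a..b} \<subseteq> frontier F \<inter> frontier G)"

definition incident :: "complex \<Rightarrow> complex set \<Rightarrow> bool" where
  "incident c F \<longleftrightarrow> c \<in> frontier F"

text \<open>
  The face next to the curve, on the left (\<open>\<eta> = \<i>\<close>) or on the right (\<open>\<eta> = - \<i>\<close>), at all
  parameters \<open>s\<close> just before (\<open>A = at_left t\<close>) or just after (\<open>A = at_right t\<close>) the
  parameter \<open>t\<close>: short displacements from \<open>curve D s\<close> along the normal lie in that face.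
\<close>

definition side_face :: "diagram \<Rightarrow> real filter \<Rightarrow> complex \<Rightarrow> complex set" where
  "side_face D A \<eta> = (THE F. F \<in> faces D \<and>
     (\<forall>\<^sub>F s in A. \<forall>\<^sub>F \<epsilon> in at_right 0.
        curve D s + of_real \<epsilon> * (\<eta> * vector_derivative (curve D) (at s)) \<in> F))"

text \<open>
  The four corners at a crossing are those on the left and right of the over strand
  before and after the crossing.
\<close>

definition before_left :: "diagram \<Rightarrow> complex \<Rightarrow> complex set" where
  "before_left D c = side_face D (at_left (over D c)) \<i>"

definition before_right :: "diagram \<Rightarrow> complex \<Rightarrow> complex set" where
  "before_right D c = side_face D (at_left (over D c)) (- \<i>)"

definition after_left :: "diagram \<Rightarrow> complex \<Rightarrow> complex set" where
  "after_left D c = side_face D (at_right (over D c)) \<i>"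

definition after_right :: "diagram \<Rightarrow> complex \<Rightarrow> complex set" where
  "after_right D c = side_face D (at_right (over D c)) (- \<i>)"

definition reduced_diagram :: "diagram \<Rightarrow> bool" where
  "reduced_diagram D \<longleftrightarrow> (\<forall>c \<in> crossings D.
     distinct [before_left D c, before_right D c, after_left D c, after_right D c])"

section \<open>Dehn relations\<close>

text \<open>
  The sign \<open>\<sigma> c\<close> records the choice, at each crossing \<open>c\<close>, of the side of the relation that is
  negated; it also absorbs the direction of travel along the over strand.
\<close>

definition sign_choice :: "diagram \<Rightarrow> (complex \<Rightarrow> int) \<Rightarrow> bool" where
  "sign_choice D \<sigma> \<longleftrightarrow> (\<forall>c \<in> crossings D. \<sigma> c = 1 \<or> \<sigma> c = - 1)"

definition dehn_coeff :: "diagram \<Rightarrow> (complex \<Rightarrow> int) \<Rightarrow> complex \<Rightarrow> complex set \<Rightarrow> int" where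
  "dehn_coeff D \<sigma> c F = \<sigma> c *
     (- of_bool (F = before_left D c) - of_bool (F = before_right D c)
      + of_bool (F = after_left D c) + of_bool (F = after_right D c))"

text \<open>
  Rows and columns follow given enumerations of the crossings and of the bounded faces. Setting
  the unbounded face to \<open>0\<close> amounts to it having no column.
\<close>

definition dehn_matrix ::
    "diagram \<Rightarrow> (complex \<Rightarrow> int) \<Rightarrow> complex list \<Rightarrow> complex set list \<Rightarrow> int mat" where
  "dehn_matrix D \<sigma> cs fs =
     Matrix.mat (length cs) (length fs) (\<lambda>(i, j). dehn_coeff D \<sigma> (cs ! i) (fs ! j))"

definition delete_col :: "'a mat \<Rightarrow> nat \<Rightarrow> 'a mat" where
  "delete_col X k =
     Matrix.mat (dim_row X) (dim_col X - 1) (\<lambda>(i, j). X $$ (i, if j < k then j else Suc j))"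

section \<open>Weighted bipartite graphs\<close>

record ('v, 'w, 'k) wbgraph =
  lverts :: "'v set"
  rverts :: "'w set"
  edges :: "('v \<times> 'w) set"
  weight :: "'v \<times> 'w \<Rightarrow> 'k"

text \<open>Weights are only meaningful on edges, so isomorphisms need not preserve them elsewhere.\<close>

definition wbgraph_iso ::
    "('v \<Rightarrow> 'x) \<Rightarrow> ('w \<Rightarrow> 'y) \<Rightarrow> ('v, 'w, 'k) wbgraph \<Rightarrow> ('x, 'y, 'k) wbgraph \<Rightarrow> bool" where
  "wbgraph_iso \<phi> \<psi> G H \<longleftrightarrow>
     bij_betw \<phi> (lverts G) (lverts H) \<and> bij_betw \<psi> (rverts G) (rverts H) \<and>
     (\<forall>v \<in> lverts G. \<forall>w \<in> rverts G. (v, w) \<in> edges G \<longleftrightarrow> (\<phi> v, \<psi> w) \<in> edges H) \<and>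
     (\<forall>(v, w) \<in> edges G. weight G (v, w) = weight H (\<phi> v, \<psi> w))"

definition matrix_graph :: "'k::zero mat \<Rightarrow> (nat, nat, 'k) wbgraph" where
  "matrix_graph X = \<lparr>lverts = {..<dim_row X}, rverts = {..<dim_col X},
     edges = {(i, j). i < dim_row X \<and> j < dim_col X \<and> X $$ (i, j) \<noteq> 0},
     weight = (\<lambda>ij. X $$ ij)\<rparr>"

definition bot_graph ::
    "diagram \<Rightarrow> (complex \<Rightarrow> int) \<Rightarrow> complex set \<Rightarrow> (complex, complex set, int) wbgraph" where
  "bot_graph D \<sigma> f = \<lparr>lverts = crossings D, rverts = bounded_faces D - {f},
     edges = {(c, F). c \<in> crossings D \<and> F \<in> bounded_faces D - {f} \<and> incident c F},
     weight = (\<lambda>(c, F). dehn_coeff D \<sigma> c F)\<rparr>"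

end

theory Submission
  imports Defs
begin

text \<open>
  Both graphs have the same vertices once rows and columns are read through the enumerations, and
  the weights agree because they are the entries of the matrix. The content is that the entry at a
  crossing \<open>c\<close> and a face \<open>F\<close> is nonzero exactly if \<open>F\<close> is incident to \<open>c\<close>. In a reduced diagram
  the four corner faces at \<open>c\<close> are distinct, so no two terms of the Dehn relation cancel and the
  entry is nonzero exactly if \<open>F\<close> is a corner face. It remains to see that the corner faces, which
  are defined by small displacements off the over strand, are all the faces with \<open>c\<close> on their
  frontier (\<open>incident_iff_side_face\<close>).

  This is a local statement. Take the velocities \<open>u\<close> and \<open>v\<close> of the two strands at \<open>c\<close> as basis, with
  coordinates \<open>X\<close> and \<open>Y\<close>. Since the strands are continuously differentiable, near \<open>c\<close> any secant of
  the first strand is almost parallel to \<open>u\<close> and any secant of the second almost parallel to \<open>v\<close>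
  (\<open>C1_strand_in_cone\<close>). A point near \<open>c\<close> off the curve lies above or below the first strand and to
  the right or left of the second; moving diagonally, along roughly \<open>a u + b v\<close> with signs \<open>a\<close> and
  \<open>b\<close>, away from both strands it can meet neither of them again, because a chord in that direction
  leaves both cones (\<open>segment_to_corner\<close>). So the point is joined, off the curve, to one of four
  fixed points \<open>c + R (a u + b v)\<close>, and only the faces of those four points come near \<open>c\<close>
  (\<open>frontier_face_iff_quadrant_face\<close>). Displacing the over strand just before or after \<open>c\<close> to its
  left or right lands in each of the four quadrants once (\<open>side_face_eq_quadrant_face\<close>).
\<close>

section \<open>Planar geometry at a transverse crossing\<close>

text \<open>
  The curve \<open>S\<close> near \<open>c\<close>, in the coordinates given by the velocities \<open>u\<close> and \<open>v\<close> of the strands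
  \<open>A\<close> and \<open>B\<close>. The cone conditions say that secants of \<open>A\<close> are almost horizontal and secants of \<open>B\<close>
  almost vertical; the span conditions say that the strands cross the box of radius \<open>R\<close> completely,
  so that the two sides of a strand can be told apart by comparing with the point of the strand
  that has the same abscissa (for \<open>A\<close>) or ordinate (for \<open>B\<close>).
\<close>

locale transverse_crossing =
  fixes S A B :: "complex set" and c u v :: complex and X Y :: "complex \<Rightarrow> real" and \<kappa> R :: real
  assumes lin_X: "bounded_linear X" and lin_Y: "bounded_linear Y"
    and chart: "X u = 1" "Y u = 0" "X v = 0" "Y v = 1"
    and coords: "z = X z *\<^sub>R u + Y z *\<^sub>R v"
    and kappa: "0 < \<kappa>" "\<kappa> \<le> 1 / 2" and R_pos: "0 < R"
    and strands: "A \<subseteq> S" "B \<subseteq> S" and center: "c \<in> S" "c \<in> A" "c \<in> B"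
    and cone_A: "p \<in> A \<Longrightarrow> q \<in> A \<Longrightarrow> \<bar>Y (p - q)\<bar> \<le> \<kappa> * \<bar>X (p - q)\<bar>"
    and cone_B: "p \<in> B \<Longrightarrow> q \<in> B \<Longrightarrow> \<bar>X (p - q)\<bar> \<le> \<kappa> * \<bar>Y (p - q)\<bar>"
    and span_A: "\<bar>x\<bar> \<le> R \<Longrightarrow> \<exists>p \<in> A. X (p - c) = x"
    and span_B: "\<bar>y\<bar> \<le> R \<Longrightarrow> \<exists>p \<in> B. Y (p - c) = y"
    and box: "p \<in> S \<Longrightarrow> \<bar>X (p - c)\<bar> \<le> R \<Longrightarrow> \<bar>Y (p - c)\<bar> \<le> R \<Longrightarrow> p \<in> A \<union> B"
begin

lemmas X_simps = linear_add[OF bounded_linear.linear[OF lin_X]]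
  linear_diff[OF bounded_linear.linear[OF lin_X]] linear_scale[OF bounded_linear.linear[OF lin_X]]
  linear_0[OF bounded_linear.linear[OF lin_X]]
lemmas Y_simps = linear_add[OF bounded_linear.linear[OF lin_Y]]
  linear_diff[OF bounded_linear.linear[OF lin_Y]] linear_scale[OF bounded_linear.linear[OF lin_Y]]
  linear_0[OF bounded_linear.linear[OF lin_Y]]

definition corner :: "real \<Rightarrow> real \<Rightarrow> complex" where
  "corner a b = c + R *\<^sub>R (a *\<^sub>R u + b *\<^sub>R v)"

definition quadrant_face :: "real \<Rightarrow> real \<Rightarrow> complex set" where
  "quadrant_face a b = connected_component_set (- S) (corner a b)"

definition near :: "complex \<Rightarrow> bool" where
  "near p \<longleftrightarrow> \<bar>X (p - c)\<bar> < R / 4 \<and> \<bar>Y (p - c)\<bar> < R / 4"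

text \<open>
  Compare a point \<open>q\<close> of the segment with the point \<open>m\<close> of \<open>A\<close> below or above \<open>p\<close>. On the way from
  \<open>p\<close> to \<open>q\<close> the ordinate moves away from \<open>m\<close>, by at least three fifths of what the abscissa changes,
  so the chord from \<open>m\<close> to \<open>q\<close> is too steep for \<open>q\<close> to lie on \<open>A\<close>. The same holds for \<open>B\<close> with the
  coordinates exchanged, and there is nothing else of the curve in the box.
\<close>

lemma segment_to_corner:
  assumes a: "a \<in> {- 1, 1}" and b: "b \<in> {- 1, 1}" and p: "near p"
    and m: "m \<in> A" "X m = X p" "b * (Y p - Y m) > 0"
    and n: "n \<in> B" "Y n = Y p" "a * (X p - X n) > 0"
  shows "closed_segment p (corner a b) \<inter> S = {}"
proof (rule ccontr)
  assume "closed_segment p (corner a b) \<inter> S \<noteq> {}"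
  then obtain q where q: "q \<in> closed_segment p (corner a b)" "q \<in> S" by blast
  then obtain \<tau> where t: "0 \<le> \<tau>" "\<tau> \<le> 1" and qt: "q = (1 - \<tau>) *\<^sub>R p + \<tau> *\<^sub>R corner a b"
    by (auto simp: in_segment)
  define x y where "x = X p - X c" and "y = Y p - Y c"
  have xy: "\<bar>x\<bar> < R / 4" "\<bar>y\<bar> < R / 4"
    using p by (auto simp: near_def x_def y_def X_simps Y_simps)
  have ab: "\<bar>a\<bar> = 1" "\<bar>b\<bar> = 1" using a b by auto
  have Xq: "X q = X p + \<tau> * (R * a - x)"
    by (simp add: qt corner_def X_simps chart x_def algebra_simps)
  have Yq: "Y q = Y p + \<tau> * (R * b - y)"
    by (simp add: qt corner_def Y_simps chart y_def algebra_simps)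
  \<comment> \<open>Because \<open>p\<close> is so much closer to \<open>c\<close> than the corner is, the segment is almost diagonal.\<close>
  have dir: "3 / 4 * R \<le> a * (R * a - x)" "a * (R * a - x) \<le> 5 / 4 * R"
      "3 / 4 * R \<le> b * (R * b - y)" "b * (R * b - y) \<le> 5 / 4 * R"
    using a b xy by auto
  have box_q: "\<bar>X (q - c)\<bar> \<le> R" "\<bar>Y (q - c)\<bar> \<le> R"
  proof -
    have "X (q - c) = (1 - \<tau>) * x + \<tau> * (R * a)" "Y (q - c) = (1 - \<tau>) * y + \<tau> * (R * b)"
      by (simp_all add: Xq Yq X_simps Y_simps x_def y_def algebra_simps)
    moreover have "\<bar>(1 - \<tau>) * z + \<tau> * w\<bar> \<le> R" if "\<bar>z\<bar> \<le> R" "\<bar>w\<bar> \<le> R" for z w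
    proof -
      have "\<bar>(1 - \<tau>) * z + \<tau> * w\<bar> \<le> (1 - \<tau>) * \<bar>z\<bar> + \<tau> * \<bar>w\<bar>"
        using t by (intro order_trans[OF abs_triangle_ineq]) (simp add: abs_mult)
      also have "\<dots> \<le> (1 - \<tau>) * R + \<tau> * R"
        using t that by (intro add_mono mult_left_mono) auto
      finally show ?thesis by (simp add: algebra_simps)
    qed
    ultimately show "\<bar>X (q - c)\<bar> \<le> R" "\<bar>Y (q - c)\<bar> \<le> R"
      using xy ab R_pos by (auto simp: abs_mult)
  qed
  \<comment> \<open>No almost diagonal chord is as flat as a secant: three quarters exceed \<open>1 / 2 * 5 / 4\<close>.\<close>
  have thin: False
    if le: "\<bar>e\<bar> \<le> \<kappa> * \<bar>\<tau> * d\<bar>" and ge: "g * e > \<tau> * (3 / 4 * R)" "\<bar>g\<bar> = 1"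
      and d: "\<bar>d\<bar> \<le> 5 / 4 * R" for d e g
  proof -
    have "\<tau> * (3 / 4 * R) < \<bar>e\<bar>" using ge by (metis abs_ge_self abs_mult less_le_trans mult_1)
    also have "\<dots> \<le> \<kappa> * (\<tau> * \<bar>d\<bar>)" using le t by (simp add: abs_mult)
    also have "\<dots> \<le> \<kappa> * (\<tau> * (5 / 4 * R))"
      using d t kappa by (intro mult_left_mono) auto
    also have "\<dots> \<le> 1 / 2 * (\<tau> * (5 / 4 * R))"
      using kappa t R_pos by (intro mult_right_mono) auto
    finally show False using t R_pos by (simp add: algebra_simps)
  qed
  have abs_dir: "\<bar>R * a - x\<bar> \<le> 5 / 4 * R" "\<bar>R * b - y\<bar> \<le> 5 / 4 * R"
    using a b xy R_pos by auto
  from box[OF q(2) box_q] show False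
  proof
    assume "q \<in> A"
    have "b * Y (q - m) = \<tau> * (b * (R * b - y)) + b * (Y p - Y m)"
      by (simp add: Y_simps Yq algebra_simps)
    also have "\<dots> > \<tau> * (3 / 4 * R)"
      using mult_left_mono[OF dir(3) t(1)] m(3) by linarith
    finally show False
      using thin[of "Y (q - m)" "R * a - x" b] cone_A[OF \<open>q \<in> A\<close> m(1)] ab abs_dir
      by (simp add: X_simps Xq m(2))
  next
    assume "q \<in> B"
    have "a * X (q - n) = \<tau> * (a * (R * a - x)) + a * (X p - X n)"
      by (simp add: X_simps Xq algebra_simps)
    also have "\<dots> > \<tau> * (3 / 4 * R)"
      using mult_left_mono[OF dir(1) t(1)] n(3) by linarith
    finally show False
      using thin[of "X (q - n)" "R * b - y" a] cone_B[OF \<open>q \<in> B\<close> n(1)] ab abs_dir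
      by (simp add: Y_simps Yq n(2))
  qed
qed

lemma in_quadrant_face:
  assumes "a \<in> {- 1, 1}" "b \<in> {- 1, 1}" "near p"
    and "m \<in> A" "X m = X p" "b * (Y p - Y m) > 0"
    and "n \<in> B" "Y n = Y p" "a * (X p - X n) > 0"
  shows "p \<in> quadrant_face a b"
proof -
  have "closed_segment p (corner a b) \<subseteq> - S"
    using segment_to_corner[OF assms] by blast
  then have "connected_component (- S) (corner a b) p"
    unfolding connected_component_def by (intro exI[of _ "closed_segment p (corner a b)"]) auto
  then show ?thesis by (simp add: quadrant_face_def)
qed

lemma near_strand_points:
  assumes "near p"
  obtains m n where "m \<in> A" "X m = X p" "n \<in> B" "Y n = Y p"
proof -
  have "\<bar>X (p - c)\<bar> \<le> R" "\<bar>Y (p - c)\<bar> \<le> R"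
    using assms R_pos by (auto simp: near_def)
  from span_A[OF this(1)] span_B[OF this(2)] that show thesis
    by (auto simp: X_simps Y_simps)
qed

text \<open>
  The signs of the quadrant are those that say on which side of each strand the point lies.
\<close>

lemma quadrant_faces_cover:
  assumes p: "near p" "p \<notin> A" "p \<notin> B"
  shows "\<exists>a \<in> {- 1, 1}. \<exists>b \<in> {- 1, 1}. p \<in> quadrant_face a b"
proof -
  obtain m n where mn: "m \<in> A" "X m = X p" "n \<in> B" "Y n = Y p"
    using near_strand_points[OF p(1)] .
  have "Y p \<noteq> Y m" using coords[of p] coords[of m] mn p by metis
  moreover have "X p \<noteq> X n" using coords[of p] coords[of n] mn p by metis
  ultimately have "sgn (Y p - Y m) \<in> {- 1, 1}" "sgn (X p - X n) \<in> {- 1, 1}"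
      "sgn (Y p - Y m) * (Y p - Y m) > 0" "sgn (X p - X n) * (X p - X n) > 0"
    by (auto simp: sgn_real_def)
  then show ?thesis using in_quadrant_face[OF _ _ p(1) mn(1,2) _ mn(3,4)] by blast
qed

text \<open>
  Outside the cone at one point of a strand, the side of the strand is decided by that point alone.
  For \<open>B\<close> the comparison with \<open>c\<close> suffices; for \<open>A\<close> the base point must be arbitrary, because the
  displaced points in \<open>side_face\<close> leave \<open>A\<close> away from \<open>c\<close>.
\<close>

lemma beside_B:
  assumes "n \<in> B" "Y n = Y p" "a \<in> {- 1, 1}" "a * X (p - c) > \<kappa> * \<bar>Y (p - c)\<bar>"
  shows "a * (X p - X n) > 0"
proof -
  have "\<bar>X (n - c)\<bar> \<le> \<kappa> * \<bar>Y (p - c)\<bar>"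
    using cone_B[OF assms(1) center(3)] assms(2) by (simp add: Y_simps)
  then show ?thesis using assms(3,4) by (auto simp: X_simps algebra_simps)
qed

lemma beside_A:
  assumes "m \<in> A" "X m = X p" "m0 \<in> A" "b \<in> {- 1, 1}" "b * Y (p - m0) > \<kappa> * \<bar>X (p - m0)\<bar>"
  shows "b * (Y p - Y m) > 0"
proof -
  have "\<bar>Y (m - m0)\<bar> \<le> \<kappa> * \<bar>X (p - m0)\<bar>"
    using cone_A[OF assms(1,3)] assms(2) by (simp add: X_simps)
  then show ?thesis using assms(4,5) by (auto simp: Y_simps algebra_simps)
qed

lemma beside_strands_in_quadrant_face:
  assumes ab: "a \<in> {- 1, 1}" "b \<in> {- 1, 1}" and p: "near p"
    and m0: "m0 \<in> A" "b * Y (p - m0) > \<kappa> * \<bar>X (p - m0)\<bar>"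
    and c: "a * X (p - c) > \<kappa> * \<bar>Y (p - c)\<bar>"
  shows "p \<in> quadrant_face a b"
proof -
  obtain m n where mn: "m \<in> A" "X m = X p" "n \<in> B" "Y n = Y p"
    using near_strand_points[OF p] .
  show ?thesis
    by (rule in_quadrant_face[OF ab p mn(1,2) beside_A[OF mn(1,2) m0(1) ab(2) m0(2)]
          mn(3,4) beside_B[OF mn(3,4) ab(1) c]])
qed

text \<open>
  A point \<open>m0 \<noteq> c\<close> of \<open>A\<close> is strictly on one side of \<open>B\<close>, and small displacements do not change
  that. With respect to \<open>A\<close> every displacement along \<open>d\<close>, however small, leaves the cone at \<open>m0\<close>.
\<close>

lemma displaced_in_quadrant_face:
  assumes ab: "a \<in> {- 1, 1}" "b \<in> {- 1, 1}" and m0: "m0 \<in> A" "near m0" "a * X (m0 - c) > 0"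
    and d: "\<kappa> * \<bar>X d\<bar> < b * Y d"
  shows "\<forall>\<^sub>F \<epsilon> in at_right 0. m0 + of_real \<epsilon> * d \<in> quadrant_face a b"
proof -
  define q where "q \<epsilon> = m0 + of_real \<epsilon> * d" for \<epsilon> :: real
  have q: "(q \<longlongrightarrow> m0) (at_right 0)"
    unfolding q_def by (auto intro!: tendsto_eq_intros)
  have X: "((\<lambda>\<epsilon>. X (q \<epsilon> - c)) \<longlongrightarrow> X (m0 - c)) (at_right 0)"
    and Y: "((\<lambda>\<epsilon>. Y (q \<epsilon> - c)) \<longlongrightarrow> Y (m0 - c)) (at_right 0)"
    by (intro bounded_linear.tendsto[OF lin_X] bounded_linear.tendsto[OF lin_Y] tendsto_intros q)+
  have "\<bar>Y (m0 - c)\<bar> \<le> \<kappa> * \<bar>X (m0 - c)\<bar>" by (rule cone_A[OF m0(1) center(2)])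
  also have "\<dots> \<le> 1 * \<bar>X (m0 - c)\<bar>" using kappa by (intro mult_right_mono) auto
  finally have "\<kappa> * \<bar>Y (m0 - c)\<bar> \<le> 1 / 2 * \<bar>X (m0 - c)\<bar>"
    using kappa by (intro mult_mono) auto
  also have "\<dots> < a * X (m0 - c)" using ab m0(3) by auto
  finally have wedge: "a * X (m0 - c) - \<kappa> * \<bar>Y (m0 - c)\<bar> > 0" by simp
  have "((\<lambda>\<epsilon>. a * X (q \<epsilon> - c) - \<kappa> * \<bar>Y (q \<epsilon> - c)\<bar>) \<longlongrightarrow>
      a * X (m0 - c) - \<kappa> * \<bar>Y (m0 - c)\<bar>) (at_right 0)"
    by (intro tendsto_intros X Y)
  then have "\<forall>\<^sub>F \<epsilon> in at_right 0. a * X (q \<epsilon> - c) - \<kappa> * \<bar>Y (q \<epsilon> - c)\<bar> > 0"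
    using wedge by (rule order_tendstoD)
  moreover have "\<forall>\<^sub>F \<epsilon> in at_right 0. \<bar>X (q \<epsilon> - c)\<bar> < R / 4"
      "\<forall>\<^sub>F \<epsilon> in at_right 0. \<bar>Y (q \<epsilon> - c)\<bar> < R / 4"
    using m0(2) order_tendstoD(2)[OF tendsto_rabs[OF X], of "R / 4"]
      order_tendstoD(2)[OF tendsto_rabs[OF Y], of "R / 4"]
    by (simp_all add: near_def)
  moreover have "\<forall>\<^sub>F \<epsilon> in at_right 0. \<epsilon> > (0::real)"
    by (rule eventually_at_right_less)
  ultimately show ?thesis
  proof eventually_elim
    case (elim \<epsilon>)
    have "q \<epsilon> - m0 = \<epsilon> *\<^sub>R d" by (simp add: q_def scaleR_conv_of_real)
    moreover have "\<epsilon> * (\<kappa> * \<bar>X d\<bar>) < \<epsilon> * (b * Y d)" using d elim(4) by simp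
    ultimately have "b * Y (q \<epsilon> - m0) > \<kappa> * \<bar>X (q \<epsilon> - m0)\<bar>"
      using elim(4) by (simp add: X_simps Y_simps abs_mult algebra_simps)
    then show ?case
      using beside_strands_in_quadrant_face[OF ab _ m0(1)] elim by (simp add: near_def q_def)
  qed
qed

lemma eventually_near: "\<forall>\<^sub>F p in nhds c. near p"
proof -
  have "((\<lambda>p. \<bar>X (p - c)\<bar>) \<longlongrightarrow> \<bar>X (c - c)\<bar>) (nhds c)"
      "((\<lambda>p. \<bar>Y (p - c)\<bar>) \<longlongrightarrow> \<bar>Y (c - c)\<bar>) (nhds c)"
    by (intro tendsto_rabs bounded_linear.tendsto[OF lin_X] bounded_linear.tendsto[OF lin_Y]
        tendsto_diff tendsto_const filterlim_ident)+
  then have "\<forall>\<^sub>F p in nhds c. \<bar>X (p - c)\<bar> < R / 4" "\<forall>\<^sub>F p in nhds c. \<bar>Y (p - c)\<bar> < R / 4"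
    using R_pos order_tendstoD(2)[of "\<lambda>p. \<bar>X (p - c)\<bar>" _ _ "R / 4"]
      order_tendstoD(2)[of "\<lambda>p. \<bar>Y (p - c)\<bar>" _ _ "R / 4"]
    by (simp_all add: X_simps Y_simps)
  then show ?thesis by eventually_elim (simp add: near_def)
qed

text \<open>The diagonal ray from \<open>c\<close> into the quadrant is outside both cones right from the start.\<close>

lemma quadrant_face_at_center:
  assumes ab: "a \<in> {- 1, 1}" "b \<in> {- 1, 1}"
  shows "c \<in> closure (quadrant_face a b)"
proof -
  define q where "q r = c + r *\<^sub>R (a *\<^sub>R u + b *\<^sub>R v)" for r :: real
  have lim: "(q \<longlongrightarrow> c) (at_right 0)"
    unfolding q_def by (auto intro!: tendsto_eq_intros)
  have "\<forall>\<^sub>F r in at_right 0. near (q r)"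
    using lim eventually_near by (auto simp: filterlim_iff)
  moreover have "\<forall>\<^sub>F r in at_right 0. r > (0::real)"
    by (rule eventually_at_right_less)
  ultimately have "\<forall>\<^sub>F r in at_right 0. q r \<in> quadrant_face a b"
  proof eventually_elim
    case (elim r)
    have "X (q r - c) = r * a" "Y (q r - c) = r * b"
      by (simp_all add: q_def X_simps Y_simps chart)
    moreover have "\<kappa> * r < r" using kappa elim(2) by simp
    ultimately show ?case
      using beside_strands_in_quadrant_face[OF ab elim(1) center(2)] ab elim(2)
      by (auto simp: abs_mult)
  qed
  then have "\<forall>\<^sub>F r in at_right 0. q r \<in> closure (quadrant_face a b)"
    by eventually_elim (rule subsetD[OF closure_subset])
  then show ?thesis
    by (rule Lim_in_closed_set[OF closed_closure _ trivial_limit_at_right_real lim])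
qed

lemma quadrant_face_component:
  assumes "a \<in> {- 1, 1}" "b \<in> {- 1, 1}"
  shows "quadrant_face a b \<in> components (- S)"
proof -
  have "quadrant_face a b \<noteq> {}" using quadrant_face_at_center[OF assms] by auto
  then have "corner a b \<in> - S" unfolding quadrant_face_def connected_component_eq_empty by simp
  then show ?thesis unfolding quadrant_face_def by (rule componentsI)
qed


text \<open>
  A face with \<open>c\<close> on its frontier has points near \<open>c\<close>, and these lie in quadrant faces; two faces
  with a common point are equal. Conversely, \<open>c\<close> is on the curve and hence in no face.
\<close>

lemma frontier_face_iff_quadrant_face:
  assumes F: "F \<in> components (- S)"
  shows "c \<in> frontier F \<longleftrightarrow> (\<exists>a \<in> {- 1, 1}. \<exists>b \<in> {- 1, 1}. F = quadrant_face a b)"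
proof
  assume "c \<in> frontier F"
  then have "c \<in> closure F" by (simp add: frontier_def)
  moreover obtain U where U: "open U" "c \<in> U" "\<And>p. p \<in> U \<Longrightarrow> near p"
    using eventually_near by (auto simp: eventually_nhds)
  ultimately obtain p where p: "p \<in> F" "near p"
    using open_Int_closure_eq_empty[OF U(1), of F] by blast
  have "p \<notin> A" "p \<notin> B" using p(1) in_components_subset[OF F] strands by auto
  from quadrant_faces_cover[OF p(2) this]
  obtain a b where ab: "a \<in> {- 1, 1}" "b \<in> {- 1, 1}" "p \<in> quadrant_face a b" by auto
  have "F = quadrant_face a b"
    using components_eq[OF F quadrant_face_component[OF ab(1,2)]] p(1) ab(3) by blast
  with ab(1,2) show "\<exists>a \<in> {- 1, 1}. \<exists>b \<in> {- 1, 1}. F = quadrant_face a b" by blast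
next
  assume "\<exists>a \<in> {- 1, 1}. \<exists>b \<in> {- 1, 1}. F = quadrant_face a b"
  then obtain a b where "a \<in> {- 1, 1}" "b \<in> {- 1, 1}" "F = quadrant_face a b" by blast
  then have "c \<in> closure F" using quadrant_face_at_center by simp
  moreover have "interior F \<subseteq> F" by (rule interior_subset)
  ultimately show "c \<in> frontier F"
    using center(1) in_components_subset[OF F] by (auto simp: frontier_def)
qed

text \<open>
  By continuity of the velocity, displacements along the normal are outside the cone not only at \<open>t\<close>
  but at all parameters near \<open>t\<close>, so they end in the quadrant face. This also settles the definite
  description in \<open>side_face\<close>: any other candidate face would share one of these points.
\<close>

lemma side_face_eq_quadrant_face:
  assumes S: "S = path_image (curve D)" and t: "curve D t = c" and del: "0 < \<delta>"
    and strand: "\<And>s. s \<in> {t - \<delta>..t + \<delta>} \<Longrightarrow> curve D s \<in> A"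
    and forward: "\<And>s. s \<in> {t - \<delta>..t + \<delta>} \<Longrightarrow> s \<noteq> t \<Longrightarrow> (s - t) * X (curve D s - c) > 0"
    and cont: "isCont (curve D) t" "isCont (\<lambda>s. vector_derivative (curve D) (at s)) t"
    and ab: "a \<in> {- 1, 1}" "b \<in> {- 1, 1}"
    and normal: "\<kappa> * \<bar>X (\<eta> * vector_derivative (curve D) (at t))\<bar>
      < b * Y (\<eta> * vector_derivative (curve D) (at t))"
    and side: "L \<le> at t" "L \<noteq> bot" "\<forall>\<^sub>F s in L. a * (s - t) > 0"
  shows "side_face D L \<eta> = quadrant_face a b"
proof -
  define d where "d s = \<eta> * vector_derivative (curve D) (at s)" for s
  have lim: "(d \<longlongrightarrow> d t) L"
    unfolding d_def by (intro tendsto_intros tendsto_mono[OF side(1)] cont(2)[unfolded isCont_def])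
  have "((\<lambda>s. b * Y (d s) - \<kappa> * \<bar>X (d s)\<bar>) \<longlongrightarrow> b * Y (d t) - \<kappa> * \<bar>X (d t)\<bar>) L"
    by (intro tendsto_intros bounded_linear.tendsto[OF lin_X] bounded_linear.tendsto[OF lin_Y] lim)
  then have "\<forall>\<^sub>F s in L. b * Y (d s) - \<kappa> * \<bar>X (d s)\<bar> > 0"
    by (rule order_tendstoD) (use normal in \<open>simp add: d_def\<close>)
  moreover have "(curve D \<longlongrightarrow> c) L"
    using tendsto_mono[OF side(1)] cont(1) t by (auto simp: isCont_def)
  then have "\<forall>\<^sub>F s in L. near (curve D s)"
    using eventually_near by (auto simp: filterlim_iff)
  moreover have "\<forall>\<^sub>F s in at t. s \<in> {t - \<delta><..<t + \<delta>}"
    using del by (intro eventually_at_in_open') auto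
  then have "\<forall>\<^sub>F s in at t. s \<in> {t - \<delta>..t + \<delta>}"
    by (rule eventually_mono) simp
  then have "\<forall>\<^sub>F s in L. s \<in> {t - \<delta>..t + \<delta>}"
    by (rule filter_leD[OF side(1)])
  ultimately have ev: "\<forall>\<^sub>F s in L. \<forall>\<^sub>F \<epsilon> in at_right 0.
      curve D s + of_real \<epsilon> * d s \<in> quadrant_face a b"
    using side(3)
  proof eventually_elim
    case (elim s)
    have "s \<noteq> t" using elim(4) by auto
    then have "(s - t) * X (curve D s - c) > 0" by (rule forward[OF elim(3)])
    then have "a * X (curve D s - c) > 0" using ab(1) elim(4) by (auto simp: zero_less_mult_iff)
    then show ?case
      using displaced_in_quadrant_face[OF ab strand[OF elim(3)] elim(2), of "d s"] elim(1) by simp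
  qed
  show ?thesis
    unfolding side_face_def d_def[symmetric] faces_def S[symmetric]
  proof (rule the_equality, intro conjI)
    show "quadrant_face a b \<in> components (- S)" by (rule quadrant_face_component[OF ab])
  next
    fix F assume F: "F \<in> components (- S) \<and> (\<forall>\<^sub>F s in L. \<forall>\<^sub>F \<epsilon> in at_right 0.
        curve D s + of_real \<epsilon> * d s \<in> F)"
    from eventually_conj[OF ev conjunct2[OF F]]
    have "\<forall>\<^sub>F s in L. \<forall>\<^sub>F \<epsilon> in at_right 0.
        curve D s + of_real \<epsilon> * d s \<in> quadrant_face a b \<inter> F"
      by eventually_elim (auto elim: eventually_elim2)
    then obtain s where "\<forall>\<^sub>F \<epsilon> in at_right 0. curve D s + of_real \<epsilon> * d s \<in> quadrant_face a b \<inter> F"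
      using eventually_happens side(2) by blast
    then obtain \<epsilon> :: real where "curve D s + of_real \<epsilon> * d s \<in> quadrant_face a b \<inter> F"
      using eventually_happens trivial_limit_at_right_real by blast
    then show "F = quadrant_face a b"
      using components_eq[OF conjunct1[OF F] quadrant_face_component[OF ab]] by blast
  qed (rule ev)
qed

end

section \<open>The two strands at a crossing of a diagram\<close>

text \<open>
  Subtracting from \<open>\<gamma>\<close> its tangent at \<open>t\<close> leaves a function with small derivative near \<open>t\<close>, hence a
  Lipschitz function with small constant. Measured along the tangent (\<open>P\<close>) a secant is therefore
  about as long as the parameter interval, and measured across (\<open>Q\<close>) it is arbitrarily shorter. The
  last conclusion is the intermediate value theorem.
\<close>

lemma C1_strand_in_cone:
  fixes \<gamma> :: "real \<Rightarrow> complex" and P Q :: "complex \<Rightarrow> real"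
  assumes C1: "\<gamma> C1_differentiable_on {t - d<..<t + d}" and d: "0 < d"
    and P: "bounded_linear P" "P (vector_derivative \<gamma> (at t)) = 1"
    and Q: "bounded_linear Q" "Q (vector_derivative \<gamma> (at t)) = 0" and kappa: "0 < \<kappa>"
  obtains \<delta> where "0 < \<delta>" and "\<delta> < d"
    and "\<And>s s'. s \<in> {t - \<delta>..t + \<delta>} \<Longrightarrow> s' \<in> {t - \<delta>..t + \<delta>} \<Longrightarrow>
      \<bar>Q (\<gamma> s - \<gamma> s')\<bar> \<le> \<kappa> * \<bar>P (\<gamma> s - \<gamma> s')\<bar>"
    and "\<And>s. s \<in> {t - \<delta>..t + \<delta>} \<Longrightarrow> s \<noteq> t \<Longrightarrow> (s - t) * P (\<gamma> s - \<gamma> t) > 0"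
    and "\<And>x. \<bar>x\<bar> \<le> \<delta> / 2 \<Longrightarrow> \<exists>s \<in> {t - \<delta>..t + \<delta>}. P (\<gamma> s - \<gamma> t) = x"
proof -
  let ?U = "{t - d<..<t + d}"
  define w where "w = vector_derivative \<gamma> (at t)"
  define D where "D s = vector_derivative \<gamma> (at s)" for s
  have der: "(\<gamma> has_vector_derivative D s) (at s)" if "s \<in> ?U" for s
    using C1 that by (auto simp: C1_differentiable_on_eq D_def vector_derivative_works)
  have "continuous_on ?U D"
    using C1 by (simp add: C1_differentiable_on_eq D_def)
  then have "isCont D t" using d by (simp add: continuous_on_eq_continuous_at)
  then have D: "D \<midarrow>t\<rightarrow> w" by (simp add: isCont_def D_def w_def)
  obtain K where K: "K > 0" "\<And>z. \<bar>P z\<bar> \<le> norm z * K"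
    using bounded_linear.pos_bounded[OF P(1)] by auto
  obtain M where M: "M > 0" "\<And>z. \<bar>Q z\<bar> \<le> norm z * M"
    using bounded_linear.pos_bounded[OF Q(1)] by auto
  define e where "e = min (1 / (2 * K)) (\<kappa> / (2 * M))"
  have e: "e > 0" "e * K \<le> 1 / 2" "e * M \<le> \<kappa> / 2"
  proof -
    show "e > 0" using K(1) M(1) kappa by (simp add: e_def)
    have "e * K \<le> 1 / (2 * K) * K" "e * M \<le> \<kappa> / (2 * M) * M"
      using K(1) M(1) by (intro mult_right_mono; simp add: e_def)+
    then show "e * K \<le> 1 / 2" "e * M \<le> \<kappa> / 2" using K(1) M(1) by simp_all
  qed
  obtain r where r: "r > 0" "\<And>s. s \<noteq> t \<Longrightarrow> norm (s - t) < r \<Longrightarrow> norm (D s - w) < e"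
    using LIM_D[OF D e(1)] by blast
  define \<delta> where "\<delta> = min r d / 2"
  let ?J = "{t - \<delta>..t + \<delta>}"
  have del: "\<delta> > 0" "\<delta> < d" "\<delta> < r" using r(1) d by (auto simp: \<delta>_def)
  have JU: "s \<in> ?U" if "s \<in> ?J" for s using that del by auto
  have bound: "norm (D s - w) \<le> e" if "s \<in> ?J" for s
  proof (cases "s = t")
    case True then show ?thesis using e(1) by (simp add: D_def w_def)
  next
    case False
    moreover have "norm (s - t) < r" using that del by auto
    ultimately show ?thesis using r(2) by (simp add: less_imp_le)
  qed
  \<comment> \<open>Up to a small Lipschitz error the strand runs along its tangent.\<close>
  have strict: "norm ((\<gamma> s - \<gamma> s') - (s - s') *\<^sub>R w) \<le> e * \<bar>s - s'\<bar>"
    if "s \<in> ?J" "s' \<in> ?J" for s s'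
  proof -
    have "norm ((\<gamma> s - s *\<^sub>R w) - (\<gamma> s' - s' *\<^sub>R w)) \<le> e * norm (s - s')"
    proof (rule differentiable_bound[where S = ?J and f' = "\<lambda>x h. h *\<^sub>R (D x - w)"])
      show "((\<lambda>s. \<gamma> s - s *\<^sub>R w) has_derivative (\<lambda>h. h *\<^sub>R (D x - w))) (at x within ?J)"
        if "x \<in> ?J" for x
      proof -
        have "((\<lambda>s. \<gamma> s - s *\<^sub>R w) has_vector_derivative D x - 1 *\<^sub>R w) (at x within ?J)"
        proof (rule has_vector_derivative_diff)
          show "(\<gamma> has_vector_derivative D x) (at x within ?J)"
            using der[OF JU[OF that]] by (rule has_vector_derivative_at_within)
          show "((\<lambda>s. s *\<^sub>R w) has_vector_derivative 1 *\<^sub>R w) (at x within ?J)"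
            unfolding has_vector_derivative_def scaleR_one
            by (intro bounded_linear_imp_has_derivative bounded_linear_scaleR_left)
        qed
        then show ?thesis by (simp add: has_vector_derivative_def)
      qed
      show "onorm (\<lambda>h. h *\<^sub>R (D x - w)) \<le> e" if "x \<in> ?J" for x
        using bound[OF that] by (intro onorm_le) (simp add: mult.commute[of e] mult_left_mono)
    qed (use that in auto)
    then show ?thesis by (simp add: algebra_simps)
  qed
  have P_close: "2 * \<bar>P (\<gamma> s - \<gamma> s') - (s - s')\<bar> \<le> \<bar>s - s'\<bar>"
    and Q_close: "2 * \<bar>Q (\<gamma> s - \<gamma> s')\<bar> \<le> \<kappa> * \<bar>s - s'\<bar>" if s: "s \<in> ?J" "s' \<in> ?J" for s s'
  proof -
    let ?z = "(\<gamma> s - \<gamma> s') - (s - s') *\<^sub>R w"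
    interpret P: bounded_linear P by (rule P)
    interpret Q: bounded_linear Q by (rule Q)
    have "P ?z = P (\<gamma> s - \<gamma> s') - (s - s')" "Q ?z = Q (\<gamma> s - \<gamma> s')"
      using P(2) Q(2) by (simp_all add: P.diff P.scaleR Q.diff Q.scaleR w_def)
    moreover have "\<bar>P ?z\<bar> \<le> (e * \<bar>s - s'\<bar>) * K"
      using K mult_right_mono[OF strict[OF s], of K] by (intro order_trans[OF K(2)]) simp
    moreover have "\<bar>Q ?z\<bar> \<le> (e * \<bar>s - s'\<bar>) * M"
      using M mult_right_mono[OF strict[OF s], of M] by (intro order_trans[OF M(2)]) simp
    moreover have "(e * \<bar>s - s'\<bar>) * K \<le> 1 / 2 * \<bar>s - s'\<bar>"
      using mult_right_mono[OF e(2), of "\<bar>s - s'\<bar>"] by (simp add: mult_ac)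
    moreover have "(e * \<bar>s - s'\<bar>) * M \<le> \<kappa> / 2 * \<bar>s - s'\<bar>"
      using mult_right_mono[OF e(3), of "\<bar>s - s'\<bar>"] by (simp add: mult_ac)
    ultimately show "2 * \<bar>P (\<gamma> s - \<gamma> s') - (s - s')\<bar> \<le> \<bar>s - s'\<bar>"
        "2 * \<bar>Q (\<gamma> s - \<gamma> s')\<bar> \<le> \<kappa> * \<bar>s - s'\<bar>" by auto
  qed
  have t_J: "t \<in> ?J" using del by auto
  show thesis
  proof (rule that[OF del(1,2)])
    fix s s' assume s: "s \<in> ?J" "s' \<in> ?J"
    have "\<bar>s - s'\<bar> \<le> \<bar>P (\<gamma> s - \<gamma> s')\<bar> + \<bar>P (\<gamma> s - \<gamma> s') - (s - s')\<bar>"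
      using abs_triangle_ineq4[of "P (\<gamma> s - \<gamma> s')" "P (\<gamma> s - \<gamma> s') - (s - s')"] by simp
    then have "\<bar>s - s'\<bar> \<le> 2 * \<bar>P (\<gamma> s - \<gamma> s')\<bar>" using P_close[OF s] by argo
    then have "\<kappa> * \<bar>s - s'\<bar> \<le> \<kappa> * (2 * \<bar>P (\<gamma> s - \<gamma> s')\<bar>)"
      using kappa by (intro mult_left_mono) auto
    then show "\<bar>Q (\<gamma> s - \<gamma> s')\<bar> \<le> \<kappa> * \<bar>P (\<gamma> s - \<gamma> s')\<bar>" using Q_close[OF s] by linarith
  next
    fix s assume s: "s \<in> ?J" "s \<noteq> t"
    have close: "2 * \<bar>P (\<gamma> s - \<gamma> t) - (s - t)\<bar> \<le> \<bar>s - t\<bar>" by (rule P_close[OF s(1) t_J])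
    show "(s - t) * P (\<gamma> s - \<gamma> t) > 0"
    proof (cases "s > t")
      case True
      then have "0 < P (\<gamma> s - \<gamma> t)" using close by argo
      then show ?thesis using True by simp
    next
      case False
      then have "s < t" using s(2) by simp
      moreover from this have "P (\<gamma> s - \<gamma> t) < 0" using close by argo
      ultimately show ?thesis by (intro mult_neg_neg) simp_all
    qed
  next
    fix x :: real assume x: "\<bar>x\<bar> \<le> \<delta> / 2"
    have J: "t - \<delta> \<in> ?J" "t + \<delta> \<in> ?J" using del by auto
    have "continuous_on ?J \<gamma>"
      by (intro continuous_at_imp_continuous_on ballI has_vector_derivative_continuous[OF der[OF JU]])
    then have "continuous_on ?J (\<lambda>s. P (\<gamma> s - \<gamma> t))"
      by (intro bounded_linear.continuous_on[OF P(1)] continuous_intros)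
    moreover have "P (\<gamma> (t - \<delta>) - \<gamma> t) \<le> x" "x \<le> P (\<gamma> (t + \<delta>) - \<gamma> t)"
      using P_close[OF J(1) t_J] P_close[OF J(2) t_J] x del by argo+
    ultimately show "\<exists>s \<in> ?J. P (\<gamma> s - \<gamma> t) = x"
      using IVT'[of "\<lambda>s. P (\<gamma> s - \<gamma> t)" "t - \<delta>" x "t + \<delta>"] del by auto
  qed
qed

text \<open>
  Division by \<open>u\<close> reduces everything to the basis \<open>1\<close> and \<open>v / u\<close>. In the last conclusion, \<open>\<i> * u\<close>
  is normal to \<open>u\<close>, so it is not a multiple of \<open>u\<close>.
\<close>

lemma coordinates_basis:
  fixes u v :: complex
  assumes "\<not> collinear {0, u, v}"
  obtains X Y :: "complex \<Rightarrow> real" where "bounded_linear X" "bounded_linear Y"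
    "X u = 1" "Y u = 0" "X v = 0" "Y v = 1"
    "\<And>z. z = X z *\<^sub>R u + Y z *\<^sub>R v" "Y (\<i> * u) \<noteq> 0"
proof -
  define Y where "Y = (\<lambda>z. Im (z / u) / Im (v / u))"
  define X where "X = (\<lambda>z. Re (z / u) - Y z * Re (v / u))"
  have Im: "Im (v / u) \<noteq> 0"
    using assms(1) by (simp add: collinear_iff_Reals complex_is_Real_iff)
  then have u: "u \<noteq> 0" by auto
  show thesis
  proof (rule that[of X Y])
    show Y: "bounded_linear Y" unfolding Y_def
      by (rule bounded_linear_compose[OF bounded_linear_divide
            bounded_linear_compose[OF bounded_linear_Im bounded_linear_divide]])
    show "bounded_linear X" unfolding X_def
      by (intro bounded_linear_sub bounded_linear_compose[OF bounded_linear_mult_left Y]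
          bounded_linear_compose[OF bounded_linear_Re bounded_linear_divide])
    show "X u = 1" "Y u = 0" "X v = 0" "Y v = 1" "Y (\<i> * u) \<noteq> 0"
      using Im u by (simp_all add: X_def Y_def)
    fix z
    have "z / u = of_real (X z) + of_real (Y z) * (v / u)"
    proof (rule complex_eqI)
      have Yz: "Y z * Im (v / u) = Im (z / u)" using Im by (simp add: Y_def)
      show "Im (z / u) = Im (of_real (X z) + of_real (Y z) * (v / u))"
        using Yz by (simp only: plus_complex.sel Im_complex_of_real scaleR_conv_of_real[symmetric]
            scaleR_complex.sel)
      show "Re (z / u) = Re (of_real (X z) + of_real (Y z) * (v / u))"
        by (simp only: plus_complex.sel Re_complex_of_real scaleR_conv_of_real[symmetric]
            scaleR_complex.sel X_def)
    qed
    then have "z / u * u = (of_real (X z) + of_real (Y z) * (v / u)) * u" by simp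
    then show "z = X z *\<^sub>R u + Y z *\<^sub>R v"
      using u by (simp add: scaleR_conv_of_real distrib_right)
  qed
qed

lemma knot_diagramD:
  assumes "knot_diagram D" "c \<in> crossings D"
  shows "pathstart (curve D) \<noteq> c" and "card (params D c) = 2"
    and "over D c \<in> params D c"
    and "t \<in> params D c \<Longrightarrow> \<exists>\<delta>>0. curve D C1_differentiable_on {t - \<delta><..<t + \<delta>}"
  using assms unfolding knot_diagram_def by blast+

lemma knot_diagram_transverse:
  assumes "knot_diagram D" "c \<in> crossings D" "s \<in> params D c" "t \<in> params D c" "s \<noteq> t"
  shows "\<not> collinear {0, vector_derivative (curve D) (at s), vector_derivative (curve D) (at t)}"
  using assms unfolding knot_diagram_def by blast

lemma knot_diagram_crossing:
  assumes D: "knot_diagram D" and c: "c \<in> crossings D"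
  obtains t where "params D c = {over D c, t}" "t \<noteq> over D c"
proof -
  have "card (params D c) = 2" "over D c \<in> params D c"
    by (rule knot_diagramD[OF D c])+
  then obtain t where "params D c = {over D c, t}" "t \<noteq> over D c"
    by (metis card_2_iff doubleton_eq_iff insertE singletonD)
  then show thesis by (rule that)
qed

text \<open>
  The base point of the parametrisation is not a crossing, so the parameter interval of the strand
  can be taken inside \<open>{0..1}\<close>, where \<open>curve D\<close> runs along the diagram.
\<close>

lemma knot_diagram_C1_strand:
  assumes D: "knot_diagram D" and c: "c \<in> crossings D" and t: "t \<in> params D c"
  obtains d where "0 < d" "{t - d<..<t + d} \<subseteq> {0..1}"
    "curve D C1_differentiable_on {t - d<..<t + d}"
proof -
  obtain e where e: "e > 0" "curve D C1_differentiable_on {t - e<..<t + e}"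
    using knot_diagramD(4)[OF D c t] by blast
  have "t \<noteq> 0" using knot_diagramD(1)[OF D c] t by (auto simp: params_def pathstart_def)
  then have "0 < t" "t < 1" using t by (auto simp: params_def)
  define d where "d = min e (min t (1 - t))"
  have "{t - d<..<t + d} \<subseteq> {t - e<..<t + e}" by (auto simp: d_def)
  then have "curve D C1_differentiable_on {t - d<..<t + d}"
    by (rule C1_differentiable_on_subset[OF e(2)])
  moreover have "0 < d" "{t - d<..<t + d} \<subseteq> {0..1}"
    using e(1) \<open>0 < t\<close> \<open>t < 1\<close> by (auto simp: d_def)
  ultimately show thesis using that by blast
qed

text \<open>
  The rest of the curve is the image of a compact set of parameters and does not contain \<open>c\<close>, so it
  has positive distance from \<open>c\<close>.
\<close>

lemma knot_diagram_near_crossing: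
  assumes D: "knot_diagram D" and c: "c \<in> crossings D" and params: "params D c = {t1, t2}"
    and del: "0 < \<delta>1" "0 < \<delta>2"
  obtains e where "0 < e" and "\<And>p. p \<in> path_image (curve D) \<Longrightarrow> dist c p < e \<Longrightarrow>
    p \<in> curve D ` {t1 - \<delta>1..t1 + \<delta>1} \<union> curve D ` {t2 - \<delta>2..t2 + \<delta>2}"
proof -
  let ?I = "{0..1} - ({t1 - \<delta>1<..<t1 + \<delta>1} \<union> {t2 - \<delta>2<..<t2 + \<delta>2})"
  have D': "path (curve D)" "pathfinish (curve D) = pathstart (curve D)"
      "pathstart (curve D) \<notin> crossings D"
    using D by (auto simp: knot_diagram_def)
  have "compact ?I" by (intro compact_diff open_Un) auto
  moreover have "continuous_on ?I (curve D)"
    using D'(1) by (auto simp: path_def intro: continuous_on_subset)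
  ultimately have "closed (curve D ` ?I)"
    by (intro compact_imp_closed compact_continuous_image)
  moreover have "c \<notin> curve D ` ?I"
  proof
    assume "c \<in> curve D ` ?I"
    then obtain s where s: "s \<in> ?I" "curve D s = c" by (metis imageE)
    show False
    proof (cases "s = 1")
      \<comment> \<open>The parameter \<open>1\<close> is not a member of \<open>params D c\<close>, but it is the base point again.\<close>
      case True
      then show False using s(2) c D'(2,3) by (simp add: pathfinish_def pathstart_def)
    next
      case False
      then have "s \<in> params D c" using s by (auto simp: params_def)
      then show False using s(1) del params by auto
    qed
  qed
  ultimately obtain e where e: "e > 0" "ball c e \<subseteq> - (curve D ` ?I)"
    by (meson ComplI open_Compl open_contains_ball)
  show thesis
  proof (rule that[OF e(1)])
    fix p assume p: "p \<in> path_image (curve D)" "dist c p < e"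
    then obtain s where s: "s \<in> {0..1}" "p = curve D s" by (auto simp: path_image_def)
    then have "s \<notin> ?I" using e(2) p(2) by fastforce
    then show "p \<in> curve D ` {t1 - \<delta>1..t1 + \<delta>1} \<union> curve D ` {t2 - \<delta>2..t2 + \<delta>2}"
      using s by force
  qed
qed

text \<open>
  The over strand is the first strand of the chart. Its left normal \<open>\<i> * u\<close> may point to either side
  of the first coordinate axis, depending on the direction of the under strand; the sign \<open>b\<close> below
  records which. Either way the four sides before and after \<open>c\<close> exhaust the four quadrants.
\<close>

lemma incident_iff_side_face:
  assumes D: "knot_diagram D" and c: "c \<in> crossings D" and F: "F \<in> faces D"
  shows "incident c F \<longleftrightarrow> F \<in> {before_left D c, before_right D c, after_left D c, after_right D c}"
proof -
  let ?\<gamma> = "curve D" and ?S = "path_image (curve D)"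
  define t1 where "t1 = over D c"
  obtain t2 where t: "params D c = {t1, t2}" "t2 \<noteq> t1"
    using knot_diagram_crossing[OF D c] t1_def by auto
  have t12: "t1 \<in> params D c" "t2 \<in> params D c" using t(1) by auto
  then have at: "?\<gamma> t1 = c" "?\<gamma> t2 = c" "t1 \<in> {0..1}"
    using t12 by (auto simp: params_def)
  define u v where "u = vector_derivative ?\<gamma> (at t1)" and "v = vector_derivative ?\<gamma> (at t2)"
  obtain d1 where d1: "0 < d1" "{t1 - d1<..<t1 + d1} \<subseteq> {0..1}"
      "?\<gamma> C1_differentiable_on {t1 - d1<..<t1 + d1}"
    using knot_diagram_C1_strand[OF D c t12(1)] .
  obtain d2 where d2: "0 < d2" "{t2 - d2<..<t2 + d2} \<subseteq> {0..1}"
      "?\<gamma> C1_differentiable_on {t2 - d2<..<t2 + d2}"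
    using knot_diagram_C1_strand[OF D c t12(2)] .
  have "\<not> collinear {0, u, v}"
    unfolding u_def v_def by (rule knot_diagram_transverse[OF D c t12 t(2)[symmetric]])
  then obtain X Y :: "complex \<Rightarrow> real" where XY: "bounded_linear X" "bounded_linear Y"
      "X u = 1" "Y u = 0" "X v = 0" "Y v = 1"
      "\<And>z. z = X z *\<^sub>R u + Y z *\<^sub>R v" "Y (\<i> * u) \<noteq> 0"
    by (rule coordinates_basis) blast
  \<comment> \<open>The cones must be thin enough not to contain the normal \<open>\<i> * u\<close>, whose direction in the chart
    depends on the angle of the crossing.\<close>
  define \<beta> where "\<beta> = Y (\<i> * u)"
  define \<kappa> where "\<kappa> = min (1 / 2) (\<bar>\<beta>\<bar> / (\<bar>X (\<i> * u)\<bar> + 1))"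
  have beta: "\<beta> \<noteq> 0" using XY(8) by (simp add: \<beta>_def)
  have kappa: "0 < \<kappa>" "\<kappa> \<le> 1 / 2"
    using beta by (simp_all only: \<kappa>_def min.cobounded1) (auto simp: add_nonneg_pos)
  have normal: "\<kappa> * \<bar>X (\<i> * u)\<bar> < \<bar>\<beta>\<bar>"
  proof -
    have "\<kappa> * \<bar>X (\<i> * u)\<bar> < \<kappa> * (\<bar>X (\<i> * u)\<bar> + 1)" using kappa(1) by simp
    also have "\<dots> \<le> \<bar>\<beta>\<bar> / (\<bar>X (\<i> * u)\<bar> + 1) * (\<bar>X (\<i> * u)\<bar> + 1)"
      unfolding \<kappa>_def by (intro mult_right_mono min.cobounded2) simp
    also have "\<dots> = \<bar>\<beta>\<bar>" using abs_ge_zero[of "X (\<i> * u)"] by simp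
    finally show ?thesis .
  qed
  obtain \<delta>1 where \<delta>1: "\<delta>1 > 0" "\<delta>1 < d1"
      "\<And>s s'. s \<in> {t1 - \<delta>1..t1 + \<delta>1} \<Longrightarrow> s' \<in> {t1 - \<delta>1..t1 + \<delta>1} \<Longrightarrow>
        \<bar>Y (?\<gamma> s - ?\<gamma> s')\<bar> \<le> \<kappa> * \<bar>X (?\<gamma> s - ?\<gamma> s')\<bar>"
      "\<And>s. s \<in> {t1 - \<delta>1..t1 + \<delta>1} \<Longrightarrow> s \<noteq> t1 \<Longrightarrow> (s - t1) * X (?\<gamma> s - ?\<gamma> t1) > 0"
      "\<And>x. \<bar>x\<bar> \<le> \<delta>1 / 2 \<Longrightarrow> \<exists>s \<in> {t1 - \<delta>1..t1 + \<delta>1}. X (?\<gamma> s - ?\<gamma> t1) = x"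
    using C1_strand_in_cone[OF d1(3,1) XY(1) _ XY(2) _ kappa(1)] XY(3,4) unfolding u_def by metis
  obtain \<delta>2 where \<delta>2: "\<delta>2 > 0" "\<delta>2 < d2"
      "\<And>s s'. s \<in> {t2 - \<delta>2..t2 + \<delta>2} \<Longrightarrow> s' \<in> {t2 - \<delta>2..t2 + \<delta>2} \<Longrightarrow>
        \<bar>X (?\<gamma> s - ?\<gamma> s')\<bar> \<le> \<kappa> * \<bar>Y (?\<gamma> s - ?\<gamma> s')\<bar>"
      "\<And>s. s \<in> {t2 - \<delta>2..t2 + \<delta>2} \<Longrightarrow> s \<noteq> t2 \<Longrightarrow> (s - t2) * Y (?\<gamma> s - ?\<gamma> t2) > 0"
      "\<And>x. \<bar>x\<bar> \<le> \<delta>2 / 2 \<Longrightarrow> \<exists>s \<in> {t2 - \<delta>2..t2 + \<delta>2}. Y (?\<gamma> s - ?\<gamma> t2) = x"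
    using C1_strand_in_cone[OF d2(3,1) XY(2) _ XY(1) _ kappa(1)] XY(5,6) unfolding v_def by metis
  define A B where "A = ?\<gamma> ` {t1 - \<delta>1..t1 + \<delta>1}" and "B = ?\<gamma> ` {t2 - \<delta>2..t2 + \<delta>2}"
  obtain e where e: "e > 0" "\<And>p. p \<in> ?S \<Longrightarrow> dist c p < e \<Longrightarrow> p \<in> A \<union> B"
    using knot_diagram_near_crossing[OF D c t(1) \<delta>1(1) \<delta>2(1)] unfolding A_def B_def by metis
  \<comment> \<open>The box has to be spanned by both strands and to lie in the disc that contains only them.\<close>
  define N where "N = norm u + norm v + 1"
  define R where "R = min (min (\<delta>1 / 2) (\<delta>2 / 2)) (e / (2 * N))"
  have N: "N > 0" by (simp add: N_def add_nonneg_pos)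
  have R: "R > 0" "R \<le> \<delta>1 / 2" "R \<le> \<delta>2 / 2" "R * N < e"
  proof -
    show "R > 0" using \<delta>1(1) \<delta>2(1) e(1) N by (simp add: R_def)
    show "R \<le> \<delta>1 / 2" "R \<le> \<delta>2 / 2"
      unfolding R_def by (intro min.coboundedI1 min.cobounded1 min.cobounded2)+
    have "R * N \<le> e / (2 * N) * N"
      using N unfolding R_def by (intro mult_right_mono min.cobounded2) simp
    also have "\<dots> = e / 2" using N by simp
    finally show "R * N < e" using e(1) by simp
  qed
  interpret transverse_crossing ?S A B c u v X Y \<kappa> R
  proof (rule transverse_crossing.intro)
    show "c \<in> ?S" using at(1,3) by (auto simp: path_image_def)
    show "A \<subseteq> ?S" "B \<subseteq> ?S"
      using \<delta>1(2) \<delta>2(2) d1(2) d2(2) unfolding A_def B_def path_image_def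
      by (intro image_mono; force)+
    show "c \<in> A" "c \<in> B"
      using \<delta>1(1) \<delta>2(1) imageI[of t1 "{t1 - \<delta>1..t1 + \<delta>1}" ?\<gamma>]
        imageI[of t2 "{t2 - \<delta>2..t2 + \<delta>2}" ?\<gamma>]
      by (simp_all add: A_def B_def at(1,2))
    show "\<bar>Y (p - q)\<bar> \<le> \<kappa> * \<bar>X (p - q)\<bar>" if "p \<in> A" "q \<in> A" for p q
      using that \<delta>1(3) by (auto simp: A_def)
    show "\<bar>X (p - q)\<bar> \<le> \<kappa> * \<bar>Y (p - q)\<bar>" if "p \<in> B" "q \<in> B" for p q
      using that \<delta>2(3) by (auto simp: B_def)
    show "\<exists>p \<in> A. X (p - c) = x" if "\<bar>x\<bar> \<le> R" for x
      using \<delta>1(5)[OF order_trans[OF that R(2)]] unfolding A_def at(1)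
      by (rule bexE) (rule bexI, assumption, rule imageI)
    show "\<exists>p \<in> B. Y (p - c) = y" if "\<bar>y\<bar> \<le> R" for y
      using \<delta>2(5)[OF order_trans[OF that R(3)]] unfolding B_def at(2)
      by (rule bexE) (rule bexI, assumption, rule imageI)
    show "p \<in> A \<union> B" if p: "p \<in> ?S" "\<bar>X (p - c)\<bar> \<le> R" "\<bar>Y (p - c)\<bar> \<le> R" for p
    proof (rule e(2)[OF p(1)])
      have "norm (p - c) = norm (X (p - c) *\<^sub>R u + Y (p - c) *\<^sub>R v)"
        by (rule arg_cong[OF XY(7)])
      also have "\<dots> \<le> \<bar>X (p - c)\<bar> * norm u + \<bar>Y (p - c)\<bar> * norm v"
        by (rule order_trans[OF norm_triangle_ineq]) simp
      also have "\<dots> \<le> R * norm u + R * norm v"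
        using p by (intro add_mono mult_right_mono) auto
      also have "\<dots> \<le> R * N" using R(1) by (simp add: N_def algebra_simps)
      finally show "dist c p < e" using R(4) by (simp add: dist_norm norm_minus_commute)
    qed
    show "z = X z *\<^sub>R u + Y z *\<^sub>R v" for z by (rule XY(7))
  qed (use XY(1-6) kappa R(1) in auto)
  have cont: "isCont ?\<gamma> t1" "isCont (\<lambda>s. vector_derivative ?\<gamma> (at s)) t1"
  proof -
    have t1: "t1 \<in> {t1 - d1<..<t1 + d1}" using d1(1) by simp
    have "?\<gamma> differentiable at t1"
      using d1(3) t1 unfolding C1_differentiable_on_eq by blast
    then show "isCont ?\<gamma> t1" by (rule differentiable_imp_continuous_within)
    show "isCont (\<lambda>s. vector_derivative ?\<gamma> (at s)) t1"
      using d1(3) t1 unfolding C1_differentiable_on_eq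
      by (simp add: continuous_on_eq_continuous_at)
  qed
  define b where "b = sgn \<beta>"
  have b: "b \<in> {- 1, 1}" "- b \<in> {- 1, 1}" "\<bar>\<beta>\<bar> = b * \<beta>"
    using beta by (auto simp: b_def sgn_real_def)
  have side: "side_face D L \<eta> = quadrant_face a b'"
    if "a \<in> {- 1, 1}" and "\<eta> = \<i> \<and> b' = b \<or> \<eta> = - \<i> \<and> b' = - b"
      and "L \<le> at t1" "L \<noteq> bot" "\<forall>\<^sub>F s in L. a * (s - t1) > 0" for L \<eta> a b'
  proof (rule side_face_eq_quadrant_face[OF refl at(1) \<delta>1(1) _ _ cont])
    have "X (- \<i> * u) = - X (\<i> * u)" "Y (- \<i> * u) = - Y (\<i> * u)"
      using linear_neg[OF bounded_linear.linear[OF XY(1)]]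
        linear_neg[OF bounded_linear.linear[OF XY(2)]] by simp_all
    then show "\<kappa> * \<bar>X (\<eta> * vector_derivative ?\<gamma> (at t1))\<bar>
        < b' * Y (\<eta> * vector_derivative ?\<gamma> (at t1))"
      using that(2) normal b(3) unfolding u_def[symmetric] \<beta>_def by auto
    show "b' \<in> {- 1, 1}" using that(2) b by auto
  qed (use that \<delta>1(4) at(1) in \<open>auto simp: A_def\<close>)
  have left: "\<forall>\<^sub>F s in at_left t1. - 1 * (s - t1) > 0"
    and right: "\<forall>\<^sub>F s in at_right t1. 1 * (s - t1) > 0"
    by (simp_all add: eventually_at_filter)
  have le: "at_left t1 \<le> at t1" "at_right t1 \<le> at t1" by (auto intro: at_le)
  have "before_left D c = quadrant_face (- 1) b" "before_right D c = quadrant_face (- 1) (- b)"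
    unfolding before_left_def before_right_def t1_def[symmetric]
    by (rule side[OF _ _ le(1) trivial_limit_at_left_real left]; simp)+
  moreover have "after_left D c = quadrant_face 1 b" "after_right D c = quadrant_face 1 (- b)"
    unfolding after_left_def after_right_def t1_def[symmetric]
    by (rule side[OF _ _ le(2) trivial_limit_at_right_real right]; simp)+
  moreover have "incident c F \<longleftrightarrow> (\<exists>a \<in> {- 1, 1}. \<exists>b \<in> {- 1, 1}. F = quadrant_face a b)"
    using frontier_face_iff_quadrant_face F by (simp add: incident_def faces_def)
  moreover have "(\<exists>a \<in> {- 1, 1}. \<exists>b \<in> {- 1, 1}. F = quadrant_face a b) \<longleftrightarrow>
      F \<in> {quadrant_face (- 1) b, quadrant_face (- 1) (- b), quadrant_face 1 b, quadrant_face 1 (- b)}"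
  proof (cases "b = 1")
    case True
    show ?thesis unfolding True by auto
  next
    case False
    then have "b = - 1" using b(1) by simp
    then show ?thesis by auto
  qed
  ultimately show ?thesis by simp
qed

section \<open>From the relations matrix to the graph\<close>

text \<open>The index shift of \<open>delete_col\<close>, seen on the enumeration of the columns.\<close>

lemma nth_remove1:
  assumes "distinct xs" "k < length xs" "j < length xs - 1"
  shows "remove1 (xs ! k) xs ! j = xs ! (if j < k then j else Suc j)"
proof -
  have "xs = take k xs @ xs ! k # drop (Suc k) xs"
    using assms(2) by (rule id_take_nth_drop)
  moreover have "xs ! k \<notin> set (take k xs)"
    using assms(1,2) by (auto simp: in_set_conv_nth nth_eq_iff_index_eq)
  ultimately have "remove1 (xs ! k) xs = take k xs @ drop (Suc k) xs"
    by (metis remove1.simps(2) remove1_append)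
  then show ?thesis using assms(2,3) by (simp add: nth_append)
qed

lemma signed_count_nonzero_iff:
  assumes "distinct [a, b, c, d]"
  shows "- of_bool (x = a) - of_bool (x = b) + of_bool (x = c) + of_bool (x = d) \<noteq> (0 :: int) \<longleftrightarrow>
    x \<in> {a, b, c, d}"
  using assms by auto

text \<open>In a reduced diagram the terms of a Dehn relation belong to distinct faces and cannot cancel.\<close>

lemma dehn_coeff_nonzero_iff:
  assumes "reduced_diagram D" "sign_choice D \<sigma>" "c \<in> crossings D"
  shows "dehn_coeff D \<sigma> c F \<noteq> 0 \<longleftrightarrow>
    F \<in> {before_left D c, before_right D c, after_left D c, after_right D c}"
proof -
  have "\<sigma> c \<noteq> 0" using assms(2,3) by (auto simp: sign_choice_def)
  moreover have "distinct [before_left D c, before_right D c, after_left D c, after_right D c]"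
    using assms(1,3) by (simp add: reduced_diagram_def)
  ultimately show ?thesis
    unfolding dehn_coeff_def mult_eq_0_iff
    by (simp only: signed_count_nonzero_iff not_False_eq_True de_Morgan_disj simp_thms)
qed

theorem lemma4p2:
  fixes D :: diagram and f :: "complex set" and \<sigma> :: "complex \<Rightarrow> int"
    and cs :: "complex list" and fs :: "complex set list" and k :: nat
  assumes "knot_diagram D" and "reduced_diagram D"
    and "f \<in> bounded_faces D" and "adjacent_faces D f (unbounded_face D)"
    and "sign_choice D \<sigma>"
    and "distinct cs" and "set cs = crossings D"
    and "distinct fs" and "set fs = bounded_faces D"
    and "k < length fs" and "fs ! k = f"
  shows "wbgraph_iso (\<lambda>i. cs ! i) (\<lambda>j. remove1 f fs ! j)
           (matrix_graph (delete_col (dehn_matrix D \<sigma> cs fs) k))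
           (bot_graph D \<sigma> f)"
proof -
  let ?M = "delete_col (dehn_matrix D \<sigma> cs fs) k"
  have dims: "dim_row ?M = length cs" "dim_col ?M = length fs - 1"
    by (simp_all add: delete_col_def dehn_matrix_def)
  have entry: "?M $$ (i, j) = dehn_coeff D \<sigma> (cs ! i) (remove1 f fs ! j)"
    if "i < length cs" "j < length fs - 1" for i j
    using that assms(8,10,11) nth_remove1[of fs k j]
    by (auto simp: delete_col_def dehn_matrix_def)
  have rest: "length (remove1 f fs) = length fs - 1" "set (remove1 f fs) = bounded_faces D - {f}"
    using assms(8-11) by (auto simp: length_remove1 set_remove1_eq)
  have cols: "bij_betw ((!) (remove1 f fs)) {..<length fs - 1} (bounded_faces D - {f})"
    using assms(8) rest by (intro bij_betw_nth) (auto simp: distinct_remove1)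
  have rows: "bij_betw ((!) cs) {..<length cs} (crossings D)"
    using assms(6,7) by (intro bij_betw_nth) auto
  have edge: "?M $$ (i, j) \<noteq> 0 \<longleftrightarrow> incident (cs ! i) (remove1 f fs ! j)"
    if "i < length cs" "j < length fs - 1" for i j
  proof -
    have "cs ! i \<in> crossings D" "remove1 f fs ! j \<in> faces D"
      using that bij_betwE[OF rows] bij_betwE[OF cols] by (auto simp: bounded_faces_def)
    then show ?thesis
      using entry[OF that] dehn_coeff_nonzero_iff[OF assms(2,5)] incident_iff_side_face[OF assms(1)]
      by simp
  qed
  show ?thesis
    using rows cols edge entry bij_betwE[OF rows] bij_betwE[OF cols]
    by (auto simp: wbgraph_iso_def matrix_graph_def bot_graph_def dims)
qed

end
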